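(* Let $d\in\mathbb N$, let $\lambda_0,\lambda_1,\ldots,\lambda_d\in\mathbb R\setminus\{0\}$ satisfy (A) or (B), where (A) means that all of $\lambda_0,\ldots,\lambda_d$ are positive, and (B) means that exactly one of $\lambda_0,\ldots,\lambda_d$ is negative, all others are positive, and $\lambda_0+\lambda_1+\cdots+\lambda_d<0$. Let $\varepsilon_1,\ldots,\varepsilon_d\in\{\pm1\}$. Then the solid angle of the orthocentric cone $C:=C_d(\lambda_0;\lambda_1,\ldots,\lambda_d;\varepsilon_1,\ldots,\varepsilon_d)$ is $$\alpha(C)=\mathbf g_d\bigl(-\lambda_0-\lambda_1-\cdots-\lambda_d;\ \lambda_1,\ldots,\lambda_d;\ \varepsilon_1\operatorname{sgn}(\lambda_1),\ldots,\varepsilon_d\operatorname{sgn}(\lambda_d)\bigr).$$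
   Context: Orthocentric cone: for $\lambda_0,\ldots,\lambda_d$ satisfying (A) or (B) there exist linearly independent vectors $v_1,\ldots,v_d\in\mathbb R^N$ (some $N\ge d$) with $\langle v_i,v_j\rangle=\frac1{\lambda_0}+\frac{\delta_{ij}}{\lambda_i}$ for all $i,j\in\{1,\ldots,d\}$ ($\delta_{ij}$ the Kronecker delta), and $C_d(\lambda_0;\lambda_1,\ldots,\lambda_d;\varepsilon_1,\ldots,\varepsilon_d):=\operatorname{pos}(\varepsilon_1v_1,\ldots,\varepsilon_dv_d)$, the positive hull (set of all nonnegative linear combinations). It is defined up to isometry. Solid angle: for a polyhedral cone $C$, $\alpha(C)=\mathbb P[\xi\in C]$, where $\xi$ is a standard Gaussian vector on the linear hull of $C$. Function $\mathbf g_d$: for $d\in\mathbb N$, $\lambda_0,\ldots,\lambda_d\in\mathbb R\setminus\{0\}$ satisfying (A) or (B), and $\varepsilon_1,\ldots,\varepsilon_d\in\{\pm1\}$, $\mathbf g_d(\lambda_0;\lambda_1,\ldots,\lambda_d;\varepsilon_1,\ldots,\varepsilon_d):=\mathbb P[\varepsilon_1\eta_1\le0,\ldots,\varepsilon_d\eta_d\le0]$, where $(\eta_1,\ldots,\eta_d)$ is a centered Gaussian vector with covariance matrix $\bigl(\frac1{\lambda_0}+\frac{\delta_{ij}}{\lambda_i}\bigr)_{i,j=1}^d$ (positive definite under (A) or (B)). The first argument tuple on the right-hand side of the claim again satisfies (A) or (B). *)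

theory Defs
  imports "HOL-Probability.Probability"
begin

text \<open>
  The index set \<open>{1,\<dots>,d}\<close> is a finite type \<open>'d\<close> with \<open>CARD('d) = d\<close>; the distinguished
  parameter \<open>\<lambda>\<^sub>0\<close> is kept apart as a separate argument.
\<close>

definition cond_A :: "real \<Rightarrow> ('d::finite \<Rightarrow> real) \<Rightarrow> bool" where
  "cond_A l0 l \<longleftrightarrow> l0 > 0 \<and> (\<forall>i. l i > 0)"

text \<open>The two disjuncts say whether the unique negative parameter is \<open>\<lambda>\<^sub>0\<close> or one of the others.\<close>

definition cond_B :: "real \<Rightarrow> ('d::finite \<Rightarrow> real) \<Rightarrow> bool" where
  "cond_B l0 l \<longleftrightarrow>
     ((l0 < 0 \<and> (\<forall>i. l i > 0)) \<or>
      (l0 > 0 \<and> (\<exists>k. l k < 0 \<and> (\<forall>i. i \<noteq> k \<longrightarrow> l i > 0)))) \<and>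
     l0 + (\<Sum>i\<in>UNIV. l i) < 0"

definition orth_matrix :: "real \<Rightarrow> ('d::finite \<Rightarrow> real) \<Rightarrow> real ^ 'd ^ 'd" where
  "orth_matrix l0 l = (\<chi> i j. 1 / l0 + (if i = j then 1 / l i else 0))"

definition pos_hull :: "('d::finite \<Rightarrow> 'a::real_vector) \<Rightarrow> 'a set" where
  "pos_hull w = {\<Sum>i\<in>UNIV. c i *\<^sub>R w i | c. \<forall>i. c i \<ge> 0}"

text \<open>
  The cone is only determined up to isometry, so it is rendered as a predicate: \<open>C\<close> is a
  realization, by some choice of the vectors \<open>v\<close>, of the cone with the given parameters.
\<close>

definition orthocentric_cone ::
  "real \<Rightarrow> ('d::finite \<Rightarrow> real) \<Rightarrow> ('d \<Rightarrow> real) \<Rightarrow> 'a::euclidean_space set \<Rightarrow> bool" where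
  "orthocentric_cone l0 l e C \<longleftrightarrow>
     (\<exists>v. inj v \<and> independent (range v) \<and>
          (\<forall>i j. v i \<bullet> v j = orth_matrix l0 l $ i $ j) \<and>
          C = pos_hull (\<lambda>i. e i *\<^sub>R v i))"

text \<open>
  Law of the standard Gaussian vector on a linear subspace \<open>L\<close>: the coordinates in an orthonormal
  basis of \<open>L\<close> are independent standard normal variables. By rotation invariance the law does not
  depend on the basis that is chosen. For \<open>L = {0}\<close> the basis is empty and the law is the point
  mass at \<open>0\<close>.
\<close>

definition std_gaussian_on :: "'a::euclidean_space set \<Rightarrow> 'a measure" where
  "std_gaussian_on L =
     (let B = (SOME B. pairwise orthogonal B \<and> (\<forall>b\<in>B. norm b = 1) \<and> span B = L)
      in distr (PiM B (\<lambda>_. density lborel std_normal_density)) borel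
           (\<lambda>z. \<Sum>b\<in>B. z b *\<^sub>R b))"

definition solid_angle :: "'a::euclidean_space set \<Rightarrow> real" where
  "solid_angle C = measure (std_gaussian_on (span C)) C"

text \<open>
  Law of the centered Gaussian vector with covariance matrix \<open>S\<close>, given by its density; meaningful
  only for positive definite \<open>S\<close>.
\<close>

definition centered_gaussian :: "real ^ 'd ^ 'd \<Rightarrow> (real ^ 'd::finite) measure" where
  "centered_gaussian S =
     density lborel
       (\<lambda>x. exp (- (x \<bullet> (matrix_inv S *v x)) / 2) / sqrt ((2 * pi) ^ CARD('d) * det S))"

definition g_fun :: "real \<Rightarrow> ('d::finite \<Rightarrow> real) \<Rightarrow> ('d \<Rightarrow> real) \<Rightarrow> real" where
  "g_fun l0 l e =
     measure (centered_gaussian (orth_matrix l0 l)) {x. \<forall>i. e i * x $ i \<le> 0}"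

end

theory Submission
  imports Defs
begin

text \<open>
  Let \<open>L\<close> be the span of \<open>v\<^sub>1, \<dots>, v\<^sub>d\<close>, let \<open>G\<close> be their Gram matrix, \<open>D = diag(\<lambda>\<^sub>1, \<dots>, \<lambda>\<^sub>d)\<close> and
  \<open>\<mu> = -\<lambda>\<^sub>0 - \<dots> - \<lambda>\<^sub>d\<close>. Parametrise \<open>L\<close> by \<open>\<eta> \<mapsto> - \<Sum>\<^sub>j \<eta>\<^sub>j \<lambda>\<^sub>j v\<^sub>j\<close>. The squared norm pulls back to
  the quadratic form of \<open>D G D\<close>, which is the inverse of the covariance matrix belonging to
  \<open>(\<mu>; \<lambda>\<^sub>1, \<dots>, \<lambda>\<^sub>d)\<close>, so the standard Gaussian law on \<open>L\<close> becomes the law of \<open>\<eta>\<close>. As the \<open>v\<^sub>j\<close> are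
  linearly independent, the point lies in the cone iff \<open>\<epsilon>\<^sub>j sgn(\<lambda>\<^sub>j) \<eta>\<^sub>j \<le> 0\<close> for all \<open>j\<close>.
\<close>

subsection \<open>Linear change of variables for Lebesgue measure\<close>

text \<open>
  The library has the linear change of variables only for well-ordered index types; it is transported
  to an arbitrary finite index type through this well-ordered copy.
\<close>

typedef 'a wo = "UNIV :: 'a set"
  morphisms of_wo to_wo by simp

lemma bij_of_wo: "bij of_wo"
  by (metis UNIV_I bijI' of_wo_inject to_wo_inverse)

instance wo :: (finite) finite
proof
  show "finite (UNIV :: 'a wo set)"
    by (rule bij_betw_finite[OF bij_of_wo, THEN iffD2]) simp
qed

instantiation wo :: (finite) wellorder
begin

text \<open>The order is pulled back along an injection into the natural numbers, which makes it
  linear and well-founded. Which enumeration is taken does not matter.\<close>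

definition less_eq_wo :: "'a wo \<Rightarrow> 'a wo \<Rightarrow> bool" where
  "x \<le> y \<longleftrightarrow> to_nat_on UNIV (of_wo x) \<le> to_nat_on UNIV (of_wo y)"

definition less_wo :: "'a wo \<Rightarrow> 'a wo \<Rightarrow> bool" where
  "x < y \<longleftrightarrow> to_nat_on UNIV (of_wo x) < to_nat_on UNIV (of_wo y)"

instance
proof
  fix x y :: "'a wo"
  assume "x \<le> y" "y \<le> x"
  then have "to_nat_on UNIV (of_wo x) = to_nat_on UNIV (of_wo y)"
    by (simp add: less_eq_wo_def)
  then show "x = y"
    using inj_on_to_nat_on[of "UNIV :: 'a set"]
    by (metis UNIV_I countable_finite finite_class.finite_UNIV inj_on_eq_iff of_wo_inject)
next
  fix P :: "'a wo \<Rightarrow> bool" and a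
  assume step: "\<And>x. (\<And>y. y < x \<Longrightarrow> P y) \<Longrightarrow> P x"
  show "P a"
    using wf_measure[of "\<lambda>x :: 'a wo. to_nat_on UNIV (of_wo x)"]
  proof (induction a rule: wf_induct_rule)
    case (less x)
    show ?case
      by (rule step, rule less) (simp add: less_wo_def)
  qed
qed (auto simp: less_eq_wo_def less_wo_def)

end

text \<open>Conjugation by \<open>r\<close> is a sign-preserving bijection between the permutations
  of the two index types, and it matches the two Leibniz sums term by term.\<close>

lemma det_reindex:
  fixes A :: "'c::comm_ring_1 ^ 'a::finite ^ 'a" and r :: "'b::finite \<Rightarrow> 'a"
  assumes "bij r"
  shows "det (\<chi> i j. A $ r i $ r j) = det A"
proof -
  have inj: "inj r" "inj (inv r)" and surj: "range r = UNIV" "range (inv r) = UNIV"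
    using assms by (auto simp: bij_def inj_imp_surj_inv surj_imp_inj_inv)
  \<comment> \<open>This and the next fact are polymorphic because each is applied both to
    \<open>r\<close> and to its inverse.\<close>
  have permutes: "map_permutation UNIV f p permutes UNIV" if "bij f" "p permutes UNIV"
    for f :: "'x \<Rightarrow> 'y" and p
    using that by (intro map_permutation_permutes)
  have inverse: "map_permutation UNIV g (map_permutation UNIV f p) = p"
    if "bij f" "p permutes UNIV" "\<And>x. g (f x) = x" for f :: "'x \<Rightarrow> 'y" and g p
    using that by (intro map_permutation_compose_inv) auto
  show ?thesis
    unfolding det_def
  proof (rule sum.reindex_bij_witness
      [where i = "map_permutation UNIV (inv r)" and j = "map_permutation UNIV r"])
    fix p :: "'b \<Rightarrow> 'b" assume "p \<in> {p. p permutes UNIV}"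
    then have p: "p permutes UNIV" by simp
    show "map_permutation UNIV (inv r) (map_permutation UNIV r p) = p"
      using assms p inj by (intro inverse) auto
    show "map_permutation UNIV r p \<in> {p. p permutes UNIV}"
      using permutes[OF assms p] by simp
    have "(\<Prod>i\<in>UNIV. A $ i $ map_permutation UNIV r p i)
      = (\<Prod>i\<in>UNIV. A $ r i $ map_permutation UNIV r p (r i))"
      by (rule prod.reindex_bij_betw[OF assms, symmetric])
    also have "\<dots> = (\<Prod>i\<in>UNIV. A $ r i $ r (p i))"
      using inj by (simp add: map_permutation_apply)
    finally show "of_int (sign (map_permutation UNIV r p))
        * (\<Prod>i\<in>UNIV. A $ i $ map_permutation UNIV r p i)
      = of_int (sign p) * (\<Prod>i\<in>UNIV. (\<chi> i j. A $ r i $ r j) $ i $ p i)"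
      using p inj by (simp add: sign_map_permutation)
  next
    fix p :: "'a \<Rightarrow> 'a" assume "p \<in> {p. p permutes UNIV}"
    then have p: "p permutes UNIV" by simp
    show "map_permutation UNIV r (map_permutation UNIV (inv r) p) = p"
      using assms p surj by (intro inverse) (auto simp: bij_imp_bij_inv f_inv_into_f)
    show "map_permutation UNIV (inv r) p \<in> {p. p permutes UNIV}"
      using permutes[OF bij_imp_bij_inv[OF assms] p] by simp
  qed
qed

section \<open>Lebesgue measure in coordinates\<close>

lemma emeasure_lborel_box_vec:
  fixes l u :: "real ^ 'a::finite"
  assumes "\<And>i. l $ i \<le> u $ i"
  shows "emeasure lborel (box l u) = (\<Prod>i\<in>UNIV. ennreal (u $ i - l $ i))"
proof -
  have "(\<Prod>b\<in>Basis. (u - l) \<bullet> b) = (\<Prod>i\<in>UNIV. u $ i - l $ i)"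
    by (simp add: Basis_vec_def UNION_singleton_eq_range prod.reindex axis_eq_axis inj_on_def
        inner_axis)
  moreover have "\<forall>b\<in>Basis. l \<bullet> b \<le> u \<bullet> b"
    using assms by (auto simp: Basis_vec_def inner_axis)
  ultimately show ?thesis
    using assms by (simp add: emeasure_lborel_box_eq prod_ennreal)
qed

lemma borel_measurable_vec_lambda:
  fixes f :: "'a \<Rightarrow> 'i::finite \<Rightarrow> real"
  assumes "\<And>i. (\<lambda>x. f x i) \<in> borel_measurable M"
  shows "(\<lambda>x. \<chi> i. f x i) \<in> borel_measurable M"
  using assms
  by (subst borel_measurable_euclidean_space) (auto simp: Basis_vec_def inner_axis)

text \<open>Lebesgue measure is determined by its values on boxes, and a box pulls back to a product
  of intervals.\<close>

lemma distr_PiM_lborel_vec: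
  "distr (PiM (UNIV :: 'i::finite set) (\<lambda>_. lborel)) borel (\<lambda>z. \<chi> i. z i)
    = (lborel :: (real ^ 'i) measure)"
proof (rule lborel_eqI[symmetric])
  interpret product_sigma_finite "\<lambda>_ :: 'i. lborel :: real measure" ..
  fix l u :: "real ^ 'i" assume "\<And>b. b \<in> Basis \<Longrightarrow> l \<bullet> b \<le> u \<bullet> b"
  then have le: "l $ i \<le> u $ i" for i
    by (simp add: cart_eq_inner_axis axis_in_Basis_iff)
  have [measurable]: "(\<lambda>z. \<chi> i. z i) \<in> PiM (UNIV :: 'i set) (\<lambda>_. lborel) \<rightarrow>\<^sub>M
      (borel :: (real ^ 'i) measure)"
    by (intro borel_measurable_vec_lambda) simp
  have "emeasure (distr (PiM UNIV (\<lambda>_. lborel)) borel (\<lambda>z. \<chi> i. z i)) (box l u)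
    = emeasure (PiM UNIV (\<lambda>_. lborel)) (PiE UNIV (\<lambda>i. {l $ i <..< u $ i}))"
    by (subst emeasure_distr)
      (auto simp: mem_box_cart space_PiM PiE_iff intro!: arg_cong2[where f = emeasure])
  also have "\<dots> = (\<Prod>i\<in>UNIV. ennreal (u $ i - l $ i))"
    using le by (subst emeasure_PiM) auto
  also have "\<dots> = emeasure lborel (box l u)"
    using le by (simp add: emeasure_lborel_box_vec)
  finally show "emeasure (distr (PiM UNIV (\<lambda>_. lborel)) borel (\<lambda>z. \<chi> i. z i)) (box l u)
      = (\<Prod>b\<in>Basis. (u - l) \<bullet> b)"
    using \<open>\<And>b. b \<in> Basis \<Longrightarrow> l \<bullet> b \<le> u \<bullet> b\<close> by (simp add: emeasure_lborel_box_eq)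
qed simp

text \<open>Relabelling coordinates pulls a box back to a box with the same side lengths, listed in
  another order.\<close>

lemma distr_lborel_vec_reindex:
  fixes r :: "'b::finite \<Rightarrow> 'a::finite"
  assumes "bij r"
  shows "distr lborel borel (\<lambda>x :: real ^ 'a. \<chi> i. x $ r i) = (lborel :: (real ^ 'b) measure)"
proof (rule lborel_eqI[symmetric])
  fix l u :: "real ^ 'b" assume lu: "\<And>b. b \<in> Basis \<Longrightarrow> l \<bullet> b \<le> u \<bullet> b"
  then have le: "l $ i \<le> u $ i" for i
    by (simp add: cart_eq_inner_axis axis_in_Basis_iff)
  have [measurable]: "(\<lambda>x :: real ^ 'a. \<chi> i. x $ r i) \<in> lborel \<rightarrow>\<^sub>M
      (borel :: (real ^ 'b) measure)"
    by (intro borel_measurable_vec_lambda) simp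
  have r: "inv r (r i) = i" "r (inv r j) = j" for i j
    using assms by (auto simp: bij_def surj_f_inv_f)
  have all_reindex: "(\<forall>i. P i (r i)) \<longleftrightarrow> (\<forall>j. P (inv r j) j)" for P
    by (metis r)
  have "(\<lambda>x :: real ^ 'a. \<chi> i. x $ r i) -` box l u
      = box (\<chi> j. l $ inv r j) (\<chi> j. u $ inv r j)"
    using all_reindex[of "\<lambda>i j. l $ i < x $ j \<and> x $ j < u $ i" for x]
    by (simp add: mem_box_cart set_eq_iff)
  then have "emeasure (distr lborel borel (\<lambda>x :: real ^ 'a. \<chi> i. x $ r i)) (box l u)
      = (\<Prod>j\<in>UNIV. ennreal (u $ inv r j - l $ inv r j))"
    using le by (simp add: emeasure_distr emeasure_lborel_box_vec)
  also have "\<dots> = (\<Prod>i\<in>UNIV. ennreal (u $ i - l $ i))"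
    using prod.reindex_bij_betw[OF bij_imp_bij_inv[OF assms], of "\<lambda>i. ennreal (u $ i - l $ i)"] .
  also have "\<dots> = emeasure lborel (box l u)"
    using le by (simp add: emeasure_lborel_box_vec)
  finally show "emeasure (distr lborel borel (\<lambda>x :: real ^ 'a. \<chi> i. x $ r i)) (box l u)
      = (\<Prod>b\<in>Basis. (u - l) \<bullet> b)"
    using lu by (simp add: emeasure_lborel_box_eq)
qed (rule sets_distr)

section \<open>Images of Lebesgue measure under invertible matrices\<close>

lemma
  fixes A :: "real ^ 'a ^ 'a::finite"
  assumes "det A \<noteq> 0"
  shows inj_matrix_vector_mult_det: "inj ((*v) A)"
    and surj_matrix_vector_mult_det: "surj ((*v) A)"
proof -
  show "inj ((*v) A)"
    using assms by (simp add: inj_matrix_vector_mult invertible_det_nz)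
  then show "surj ((*v) A)"
    by (intro linear_injective_imp_surjective) simp_all
qed

lemma borel_measurable_matrix_vector_mult [measurable]:
  fixes A :: "real ^ 'a::finite ^ 'b::finite"
  shows "(*v) A \<in> borel \<rightarrow>\<^sub>M borel"
  by (intro borel_measurable_continuous_onI matrix_vector_mult_linear_continuous_on)

text \<open>Openness makes \<open>S\<close> and its image Borel, so \<open>lborel\<close> and
  \<open>lebesgue\<close> agree on them. Boundedness makes the measures finite, so the real-valued
  determinant formula carries over to \<open>ennreal\<close>.\<close>

lemma emeasure_lborel_matrix_image_wellorder:
  fixes A :: "real ^ 'a::{finite,wellorder} ^ 'a::_"
  assumes "open S" "bounded S" "det A \<noteq> 0"
  shows "emeasure lborel ((*v) A ` S) = ennreal \<bar>det A\<bar> * emeasure lborel S"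
proof -
  have "open ((*v) A ` S)"
    using assms(1) surj_matrix_vector_mult_det[OF assms(3)]
    by (intro open_surjective_linear_image) auto
  then have borel: "S \<in> sets borel" "(*v) A ` S \<in> sets borel"
    using assms by auto
  have S: "S \<in> lmeasurable"
    using assms by (simp add: bounded_set_imp_lmeasurable)
  then have AS: "(*v) A ` S \<in> lmeasurable"
    by (intro measurable_linear_image) auto
  have "emeasure lborel ((*v) A ` S) = emeasure lebesgue ((*v) A ` S)"
    using borel by simp
  also have "\<dots> = ennreal (measure lebesgue ((*v) A ` S))"
    using AS by (rule emeasure_eq_measure2)
  also have "measure lebesgue ((*v) A ` S) = \<bar>det A\<bar> * measure lebesgue S"
    using measure_linear_image[OF matrix_vector_mul_linear S, of A] by simp
  also have "ennreal \<dots> = ennreal \<bar>det A\<bar> * emeasure lebesgue S"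
    using emeasure_eq_measure2[OF S] by (simp add: ennreal_mult')
  also have "emeasure lebesgue S = emeasure lborel S"
    using borel by simp
  finally show ?thesis .
qed

text \<open>The relabelling \<open>R\<close> preserves Lebesgue measure and conjugates
  \<open>A\<close> to a matrix \<open>B\<close> over the well-ordered copy with the same
  determinant.\<close>

lemma emeasure_lborel_matrix_image:
  fixes A :: "real ^ 'a ^ 'a::finite"
  assumes "open S" "bounded S" "det A \<noteq> 0"
  shows "emeasure lborel ((*v) A ` S) = ennreal \<bar>det A\<bar> * emeasure lborel S"
proof -
  define R :: "real ^ 'a \<Rightarrow> real ^ 'a wo" where "R = (\<lambda>x. \<chi> i. x $ of_wo i)"
  define B :: "real ^ 'a wo ^ 'a wo" where "B = (\<chi> i j. A $ of_wo i $ of_wo j)"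
  have lin: "linear R"
    by (auto intro!: linearI simp: R_def vec_eq_iff)
  then have cont: "continuous_on T R" for T
    by (simp add: linear_continuous_on linear_linear)
  have "inj R"
  proof (rule injI)
    fix x y assume "R x = R y"
    then have "x $ of_wo i = y $ of_wo i" for i
      by (simp add: R_def vec_eq_iff)
    from this[of "to_wo i" for i] show "x = y"
      by (simp add: vec_eq_iff to_wo_inverse)
  qed
  have "surj R"
  proof (rule surjI)
    fix y show "R (\<chi> i. y $ to_wo i) = y"
      by (simp add: R_def vec_eq_iff of_wo_inverse)
  qed
  have RA: "R (A *v x) = B *v R x" for x
  proof (subst vec_eq_iff, intro allI)
    fix i
    show "R (A *v x) $ i = (B *v R x) $ i"
      using sum.reindex_bij_betw[OF bij_of_wo, of "\<lambda>j. A $ of_wo i $ j * x $ j"]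
      by (simp add: R_def B_def matrix_vector_mult_def)
  qed
  have det_B: "det B = det A"
    unfolding B_def by (rule det_reindex[OF bij_of_wo])
  have open_R: "open (R ` T)" if "open T" for T
    using that lin \<open>surj R\<close> by (rule open_surjective_linear_image)
  \<comment> \<open>For open sets the image under \<open>R\<close> is open, hence Borel, so the
    invariance of \<open>lborel\<close> under \<open>R\<close> applies to it.\<close>
  have R: "emeasure lborel (R ` T) = emeasure lborel T" if "open T" for T
  proof -
    have "R ` T \<in> sets borel"
      using open_R[OF that] by simp
    moreover have "R \<in> lborel \<rightarrow>\<^sub>M borel"
      using cont by (simp add: borel_measurable_continuous_onI)
    ultimately have "emeasure (distr lborel borel R) (R ` T) = emeasure lborel (R -` R ` T)"
      by (simp add: emeasure_distr)
    moreover have "distr lborel borel R = lborel"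
      unfolding R_def by (rule distr_lborel_vec_reindex[OF bij_of_wo])
    ultimately show ?thesis
      using \<open>inj R\<close> by (simp add: inj_vimage_image_eq)
  qed
  have "open ((*v) A ` S)"
    using assms(1) surj_matrix_vector_mult_det[OF assms(3)]
    by (intro open_surjective_linear_image) auto
  then have "emeasure lborel ((*v) A ` S) = emeasure lborel (R ` (*v) A ` S)"
    by (rule R[symmetric])
  also have "R ` (*v) A ` S = (*v) B ` R ` S"
    by (simp only: image_image RA)
  also have "emeasure lborel \<dots> = ennreal \<bar>det B\<bar> * emeasure lborel (R ` S)"
    using assms det_B lin
    by (intro emeasure_lborel_matrix_image_wellorder open_R bounded_linear_image)
      (simp_all add: linear_linear)
  also have "\<dots> = ennreal \<bar>det A\<bar> * emeasure lborel S"
    by (simp only: R[OF assms(1)] det_B)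
  finally show ?thesis .
qed

text \<open>It suffices to compare boxes. A box is the image under \<open>A\<close> of its own
  preimage, which is open and bounded, so the image formula gives the factor.\<close>

lemma lborel_eq_density_distr_matrix:
  fixes A :: "real ^ 'a ^ 'a::finite"
  assumes "det A \<noteq> 0"
  shows "lborel = density (distr lborel borel ((*v) A)) (\<lambda>_. ennreal \<bar>det A\<bar>)"
proof (rule lborel_eqI)
  fix l u :: "real ^ 'a" assume lu: "\<And>b. b \<in> Basis \<Longrightarrow> l \<bullet> b \<le> u \<bullet> b"
  let ?S = "(*v) A -` box l u"
  have "open ?S"
    by (intro open_vimage open_box matrix_vector_mult_linear_continuous_on)
  moreover have "bounded ?S"
  proof -
    obtain g where g: "linear g" "g \<circ> (*v) A = id"
      using linear_injective_left_inverse[OF matrix_vector_mul_linear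
          inj_matrix_vector_mult_det[OF assms]] by blast
    have "?S \<subseteq> g ` box l u"
      using g(2) by (metis comp_apply id_apply image_eqI subsetI vimageE)
    moreover have "bounded (g ` box l u)"
      using g(1) by (simp add: bounded_linear_image linear_linear)
    ultimately show ?thesis
      by (rule bounded_subset[rotated])
  qed
  ultimately have "emeasure lborel ((*v) A ` ?S) = ennreal \<bar>det A\<bar> * emeasure lborel ?S"
    using assms by (rule emeasure_lborel_matrix_image)
  moreover have "(*v) A ` ?S = box l u"
    using surj_matrix_vector_mult_det[OF assms] by (rule surj_image_vimage_eq)
  ultimately show "emeasure (density (distr lborel borel ((*v) A)) (\<lambda>_. ennreal \<bar>det A\<bar>)) (box l u)
      = (\<Prod>b\<in>Basis. (u - l) \<bullet> b)"
    using lu by (simp add: emeasure_density_const emeasure_distr emeasure_lborel_box_eq)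
qed simp

lemma nn_integral_lborel_matrix:
  fixes A :: "real ^ 'a ^ 'a::finite"
  assumes "det A \<noteq> 0" and [measurable]: "f \<in> borel_measurable borel"
  shows "(\<integral>\<^sup>+x. f x \<partial>lborel) = \<bar>det A\<bar> * (\<integral>\<^sup>+x. f (A *v x) \<partial>lborel)"
  by (subst lborel_eq_density_distr_matrix[OF assms(1)])
    (simp add: nn_integral_density nn_integral_distr nn_integral_cmult)

subsection \<open>The standard Gaussian law on a subspace\<close>

text \<open>Both measures agree on rectangles: there the integrand is a product of functions of
  single coordinates, and its integral factorises.\<close>

lemma PiM_density_lborel:
  fixes f :: "real \<Rightarrow> real"
  assumes [measurable]: "f \<in> borel_measurable borel" and nonneg: "\<And>x. 0 \<le> f x"
    and "prob_space (density lborel f)"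
  shows "PiM (UNIV :: 'i::finite set) (\<lambda>_. density lborel f)
    = density (PiM UNIV (\<lambda>_. lborel)) (\<lambda>z. \<Prod>i\<in>UNIV. f (z i))"
proof (rule product_sigma_finite.PiM_eqI[symmetric])
  show "product_sigma_finite (\<lambda>_ :: 'i. density lborel f)"
    using assms(3) by (simp add: product_sigma_finite_def prob_space_imp_sigma_finite)
  interpret L: product_sigma_finite "\<lambda>_ :: 'i. lborel :: real measure" ..
  show "sets (density (PiM UNIV (\<lambda>_. lborel)) (\<lambda>z. \<Prod>i\<in>UNIV. f (z i)))
      = sets (PiM (UNIV :: 'i set) (\<lambda>_. density lborel f))"
    by (simp cong: sets_PiM_cong)
  fix A :: "'i \<Rightarrow> real set"
  assume "\<And>i. i \<in> UNIV \<Longrightarrow> A i \<in> sets (density lborel f)"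
  then have [measurable]: "A i \<in> sets borel" for i
    by simp
  have "emeasure (density (PiM UNIV (\<lambda>_. lborel)) (\<lambda>z. \<Prod>i\<in>UNIV. f (z i))) (PiE UNIV A)
      = (\<integral>\<^sup>+z. ennreal (\<Prod>i\<in>UNIV. f (z i)) * indicator (PiE UNIV A) z \<partial>PiM UNIV (\<lambda>_. lborel))"
    by (subst emeasure_density) (auto intro!: sets_PiM_I_finite)
  also have "\<dots> = (\<integral>\<^sup>+z. (\<Prod>i\<in>UNIV. ennreal (f (z i)) * indicator (A i) (z i))
      \<partial>PiM UNIV (\<lambda>_. lborel))"
    using nonneg
    by (intro nn_integral_cong)
      (auto simp: prod.distrib prod_ennreal indicator_def PiE_iff intro!: prod.neutral)
  also have "\<dots> = (\<Prod>i\<in>UNIV. \<integral>\<^sup>+x. ennreal (f x) * indicator (A i) x \<partial>lborel)"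
    by (subst L.product_nn_integral_prod) auto
  also have "\<dots> = (\<Prod>i\<in>UNIV. emeasure (density lborel f) (A i))"
    by (simp add: emeasure_density)
  finally show "emeasure (density (PiM UNIV (\<lambda>_. lborel)) (\<lambda>z. \<Prod>i\<in>UNIV. f (z i))) (PiE UNIV A)
      = (\<Prod>i\<in>UNIV. emeasure (density lborel f) (A i))" .
qed simp

lemma distr_PiM_std_normal_vec:
  "distr (PiM (UNIV :: 'i::finite set) (\<lambda>_. density lborel std_normal_density)) borel
      (\<lambda>z. \<chi> i. z i)
    = density lborel (\<lambda>x :: real ^ 'i. exp (- (x \<bullet> x) / 2) / sqrt ((2 * pi) ^ CARD('i)))"
proof -
  have prod: "(\<Prod>i\<in>UNIV. std_normal_density (x $ i))
    = exp (- (x \<bullet> x) / 2) / sqrt ((2 * pi) ^ CARD('i))" for x :: "real ^ 'i"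
  proof -
    have "(\<Prod>i\<in>UNIV. std_normal_density (x $ i))
      = (1 / sqrt (2 * pi)) ^ CARD('i) * (\<Prod>i\<in>UNIV. exp (- (x $ i)\<^sup>2 / 2))"
      by (simp add: std_normal_density_def prod_dividef power_one_over)
    also have "(\<Prod>i\<in>UNIV. exp (- (x $ i)\<^sup>2 / 2)) = exp (- (x \<bullet> x) / 2)"
      by (simp add: exp_sum[symmetric] inner_vec_def power2_eq_square sum_negf sum_divide_distrib)
    finally show ?thesis
      unfolding real_sqrt_power by (simp add: power_one_over)
  qed
  have [measurable]: "(\<lambda>z. \<chi> i. z i) \<in> PiM (UNIV :: 'i set) (\<lambda>_. lborel) \<rightarrow>\<^sub>M
      (borel :: (real ^ 'i) measure)"
    by (intro borel_measurable_vec_lambda) simp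
  \<comment> \<open>Writing \<open>z i\<close> as a coordinate of the vector exhibits the density as
    a function of that vector, so it passes through the pushforward.\<close>
  have "PiM (UNIV :: 'i set) (\<lambda>_. density lborel std_normal_density)
    = density (PiM UNIV (\<lambda>_. lborel)) (\<lambda>z. \<Prod>i\<in>UNIV. std_normal_density ((\<chi> i. z i) $ i))"
    by (simp add: PiM_density_lborel prob_space_normal_density)
  then show ?thesis
    unfolding prod by (simp add: density_distr distr_PiM_lborel_vec[symmetric])
qed

text \<open>The orthonormal basis chosen inside \<open>std_gaussian_on\<close> is indexed by
  \<open>'d\<close>. Only its orthonormality and span are exposed, so later arguments hold for
  whichever basis was chosen.\<close>

lemma std_gaussian_on_subspace:
  fixes L :: "(real ^ 'n::finite) set"
  assumes "subspace L" "dim L = CARD('d::finite)"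
  obtains b :: "'d::finite \<Rightarrow> real ^ 'n"
  where "\<And>i j. b i \<bullet> b j = (if i = j then 1 else 0)" "span (range b) = L"
    "std_gaussian_on L
      = distr (density lborel (\<lambda>x :: real ^ 'd. exp (- (x \<bullet> x) / 2) / sqrt ((2 * pi) ^ CARD('d))))
          borel (\<lambda>x. \<Sum>i\<in>UNIV. x $ i *\<^sub>R b i)"
proof -
  let ?\<nu> = "density lborel std_normal_density"
  define B where "B = (SOME B. pairwise orthogonal B \<and> (\<forall>b\<in>B. norm b = 1) \<and> span B = L)"
  have B: "pairwise orthogonal B" "\<forall>b\<in>B. norm b = 1" "span B = L"
  proof -
    have "\<exists>B. pairwise orthogonal B \<and> (\<forall>b\<in>B. norm b = 1) \<and> span B = L"
      using orthonormal_basis_subspace[OF assms(1)] by metis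
    from someI_ex[OF this] show "pairwise orthogonal B" "\<forall>b\<in>B. norm b = 1" "span B = L"
      by (simp_all add: B_def)
  qed
  have "0 \<notin> B"
    using B(2) by force
  with B(1) have "independent B"
    by (rule pairwise_orthogonal_independent)
  then have "finite B" "card B = CARD('d)"
    using B(3) assms(2) by (auto simp: independent_imp_finite dim_eq_card)
  then obtain b :: "'d \<Rightarrow> real ^ 'n" where b: "bij_betw b UNIV B"
    using finite_same_card_bij[of "UNIV :: 'd set" B] by auto
  then have inj: "inj b" and range: "range b = B"
    by (auto simp: bij_betw_def)
  have "std_gaussian_on L = distr (PiM B (\<lambda>_. ?\<nu>)) borel (\<lambda>z. \<Sum>c\<in>B. z c *\<^sub>R c)"
    by (simp only: std_gaussian_on_def Let_def B_def)
  \<comment> \<open>The map is factored twice: first through functions on \<open>'d\<close>, by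
    relabelling the basis along \<open>b\<close>, then through vectors, where the law has a
    density.\<close>
  also have "\<dots> = distr (PiM B (\<lambda>_. ?\<nu>)) borel
      ((\<lambda>z. \<Sum>i\<in>UNIV. z i *\<^sub>R b i) \<circ> (\<lambda>\<omega>. \<lambda>i\<in>UNIV. \<omega> (b i)))"
    using sum.reindex_bij_betw[OF b, of "\<lambda>c. z c *\<^sub>R c" for z] by (simp add: comp_def)
  also have "\<dots> = distr (distr (PiM B (\<lambda>_. ?\<nu>)) (PiM UNIV (\<lambda>_. ?\<nu>))
      (\<lambda>\<omega>. \<lambda>i\<in>UNIV. \<omega> (b i))) borel (\<lambda>z. \<Sum>i\<in>UNIV. z i *\<^sub>R b i)"
  proof (rule distr_distr[symmetric])
    show "(\<lambda>z. \<Sum>i\<in>UNIV. z i *\<^sub>R b i) \<in> PiM UNIV (\<lambda>_. ?\<nu>) \<rightarrow>\<^sub>M borel"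
      by measurable
    show "(\<lambda>\<omega>. \<lambda>i\<in>UNIV. \<omega> (b i)) \<in> PiM B (\<lambda>_. ?\<nu>) \<rightarrow>\<^sub>M PiM UNIV (\<lambda>_. ?\<nu>)"
      using range by (intro measurable_restrict measurable_component_singleton) auto
  qed
  also have "distr (PiM B (\<lambda>_. ?\<nu>)) (PiM UNIV (\<lambda>_. ?\<nu>)) (\<lambda>\<omega>. \<lambda>i\<in>UNIV. \<omega> (b i))
      = PiM UNIV (\<lambda>_. ?\<nu>)"
    using inj range by (intro distr_PiM_reindex) (auto simp: prob_space_normal_density)
  also have "distr \<dots> borel (\<lambda>z. \<Sum>i\<in>UNIV. z i *\<^sub>R b i)
      = distr (PiM UNIV (\<lambda>_. ?\<nu>)) borel ((\<lambda>x. \<Sum>i\<in>UNIV. x $ i *\<^sub>R b i) \<circ> (\<lambda>z. \<chi> i. z i))"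
    by (simp add: comp_def)
  also have "\<dots> = distr (distr (PiM UNIV (\<lambda>_. ?\<nu>)) borel (\<lambda>z. \<chi> i. z i)) borel
      (\<lambda>x. \<Sum>i\<in>UNIV. x $ i *\<^sub>R b i)"
    by (rule distr_distr[symmetric])
      (auto intro!: borel_measurable_vec_lambda borel_measurable_sum)
  also note distr_PiM_std_normal_vec
  finally have "std_gaussian_on L = distr (density lborel
      (\<lambda>x :: real ^ 'd. exp (- (x \<bullet> x) / 2) / sqrt ((2 * pi) ^ CARD('d))))
      borel (\<lambda>x. \<Sum>i\<in>UNIV. x $ i *\<^sub>R b i)" .
  moreover have "b i \<bullet> b j = (if i = j then 1 else 0)" for i j
    using B(1,2) inj range
    by (auto simp: pairwise_def orthogonal_def norm_eq_1 inj_eq)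
  moreover have "span (range b) = L"
    using B(3) range by simp
  ultimately show thesis
    using that by blast
qed

subsection \<open>Orthocentric cones\<close>

text \<open>
  The inverse of \<open>1/\<mu> J + D\<^sup>-\<^sup>1\<close> with \<open>D = diag(l)\<close> and \<open>J\<close> the all-ones matrix is
  \<open>D - D J D / (\<mu> + tr D)\<close> (Sherman--Morrison), and \<open>\<mu> + tr D = -l0\<close>.
\<close>

lemma orth_matrix_mult_inverse:
  assumes "l0 \<noteq> 0" "\<And>i. l i \<noteq> 0" "l0 + (\<Sum>i\<in>UNIV. l i) \<noteq> 0"
  shows "orth_matrix (- l0 - (\<Sum>i\<in>UNIV. l i)) l ** (\<chi> i j. l i * l j * orth_matrix l0 l $ i $ j)
    = mat 1"
proof -
  define s m where "s = (\<Sum>i\<in>UNIV. l i)" and "m = - l0 - s"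
  have m: "m \<noteq> 0"
    using assms(3) by (simp add: m_def s_def)
  have "(orth_matrix m l ** (\<chi> i j. l i * l j * orth_matrix l0 l $ i $ j)) $ i $ k
      = (mat 1 :: real ^ _ ^ _) $ i $ k" for i k
  proof -
    have "(orth_matrix m l ** (\<chi> i j. l i * l j * orth_matrix l0 l $ i $ j)) $ i $ k
      = (\<Sum>j\<in>UNIV. (1 / m + (if i = j then 1 / l i else 0))
          * (l j * l k * (1 / l0 + (if j = k then 1 / l j else 0))))"
      by (simp add: matrix_matrix_mult_def orth_matrix_def)
    also have "\<dots> = (\<Sum>j\<in>UNIV. l j * (l k / l0 / m) + (if j = k then l k / m else 0)
          + (if i = j then l k / l0 else 0) + (if i = j then (if i = k then 1 else 0) else 0))"
      by (intro sum.cong refl) (use assms(1,2) m in \<open>auto simp: field_simps\<close>)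
    also have "\<dots> = s * (l k / l0 / m) + l k / m + l k / l0 + (if i = k then 1 else 0)"
      \<comment> \<open>The terms other than the identity entry collect into a multiple of
        \<open>s + l0 + m\<close>, which vanishes by the choice of \<open>m\<close>.\<close>
      unfolding s_def by (simp add: sum.distrib flip: sum_distrib_right sum_divide_distrib)
    also have "s * (l k / l0 / m) + l k / m + l k / l0 = (s + l0 + m) * (l k / (l0 * m))"
      using assms(1) m by (simp add: field_simps)
    finally show ?thesis
      by (simp add: mat_def m_def)
  qed
  then show ?thesis
    by (simp add: vec_eq_iff m_def s_def)
qed

text \<open>\<open>matrix_inv\<close> picks some two-sided inverse. For square matrices a right
  inverse is two-sided, and inverses are unique.\<close>

lemma matrix_inv_eqI:
  fixes A :: "real ^ 'a ^ 'a::finite"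
  assumes "A ** B = mat 1"
  shows "matrix_inv A = B"
proof -
  have "\<exists>A'. A ** A' = mat 1 \<and> A' ** A = mat 1"
    using assms matrix_left_right_inverse by metis
  then have "matrix_inv A ** A = mat 1"
    unfolding matrix_inv_def by (rule someI2_ex) simp
  then show ?thesis
    using assms by (metis matrix_mul_assoc matrix_mul_lid matrix_mul_rid)
qed

text \<open>Independence concerns sums over the set \<open>range v\<close>; injectivity of
  \<open>v\<close> turns them into sums over indices.\<close>

lemma independent_sum_eqD:
  fixes v :: "'d::finite \<Rightarrow> 'a::real_vector"
  assumes "inj v" "independent (range v)"
    and "(\<Sum>i\<in>UNIV. f i *\<^sub>R v i) = (\<Sum>i\<in>UNIV. g i *\<^sub>R v i)"
  shows "f i = g i"
proof -
  have "(\<Sum>w\<in>range v. (f (inv v w) - g (inv v w)) *\<^sub>R w) = 0"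
    using assms(1,3) by (simp add: sum.reindex scaleR_diff_left sum_subtractf)
  from independentD[OF assms(2) _ subset_refl this, of "v i"] show ?thesis
    using assms(1) by simp
qed

lemma linear_sum_scaleR_vec: "linear (\<lambda>x :: real ^ 'd::finite. \<Sum>i\<in>UNIV. x $ i *\<^sub>R w i)"
  by (intro linearI) (simp_all add: scaleR_add_left sum.distrib scaleR_sum_right)

text \<open>The hull is the image of the closed orthant under an injective linear map. This will
  make the cone Borel.\<close>

lemma closed_pos_hull:
  fixes w :: "'d::finite \<Rightarrow> 'a::euclidean_space"
  assumes "inj (\<lambda>x :: real ^ 'd. \<Sum>i\<in>UNIV. x $ i *\<^sub>R w i)"
  shows "closed (pos_hull w)"
proof -
  have "pos_hull w = (\<lambda>x :: real ^ 'd. \<Sum>i\<in>UNIV. x $ i *\<^sub>R w i) ` {x. \<forall>i. 0 \<le> x $ i}"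
  proof (intro equalityI subsetI)
    fix y assume "y \<in> pos_hull w"
    then obtain c where "y = (\<Sum>i\<in>UNIV. c i *\<^sub>R w i)" "\<forall>i. 0 \<le> c i"
      by (auto simp: pos_hull_def)
    then show "y \<in> (\<lambda>x :: real ^ 'd. \<Sum>i\<in>UNIV. x $ i *\<^sub>R w i) ` {x. \<forall>i. 0 \<le> x $ i}"
      by (intro image_eqI[of _ _ "\<chi> i. c i"]) auto
  qed (auto simp: pos_hull_def)
  moreover have "closed {x :: real ^ 'd. \<forall>i. 0 \<le> x $ i}"
    by (intro closed_Collect_all closed_Collect_le continuous_intros)
  ultimately show ?thesis
    using assms by (simp add: closed_injective_linear_image linear_sum_scaleR_vec)
qed

text \<open>The residual lies in the span and is orthogonal to it, hence to itself.\<close>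

lemma orthonormal_expansion:
  fixes b :: "'d::finite \<Rightarrow> 'a::euclidean_space"
  assumes "\<And>i j. b i \<bullet> b j = (if i = j then 1 else 0)" "x \<in> span (range b)"
  shows "x = (\<Sum>i\<in>UNIV. (x \<bullet> b i) *\<^sub>R b i)"
proof -
  let ?w = "x - (\<Sum>i\<in>UNIV. (x \<bullet> b i) *\<^sub>R b i)"
  have orth: "orthogonal ?w y" if "y \<in> range b" for y
    using that
    by (auto simp: orthogonal_def inner_diff_left inner_sum_left assms(1) if_distrib cong: if_cong)
  have "?w \<in> span (range b)"
    by (intro span_diff[OF assms(2)] span_sum span_scale span_base rangeI)
  from orthogonal_to_span[OF this orth] have "orthogonal ?w ?w" .
  then have "?w = 0"
    unfolding orthogonal_self .
  then show ?thesis
    by (rule eq_iff_diff_eq_0[THEN iffD2])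
qed

theorem theorem1p4:
  fixes l0 :: real and l e :: "'d::finite \<Rightarrow> real" and C :: "(real ^ 'n::finite) set"
  assumes "l0 \<noteq> 0" and "\<And>i. l i \<noteq> 0"
    and "cond_A l0 l \<or> cond_B l0 l"
    and "\<And>i. e i \<in> {-1, 1}"
    and "orthocentric_cone l0 l e C"
  shows "solid_angle C = g_fun (- l0 - (\<Sum>i\<in>UNIV. l i)) l (\<lambda>i. e i * sgn (l i))"
proof -
  define m where "m = - l0 - (\<Sum>i\<in>UNIV. l i)"
  \<comment> \<open>The sum is positive under (A) and negative under (B), so \<open>m\<close> is
    nonzero and the inverse formula applies.\<close>
  have nonzero: "l0 + (\<Sum>i\<in>UNIV. l i) \<noteq> 0"
  proof -
    have "0 < l0 + (\<Sum>i\<in>UNIV. l i)" if "cond_A l0 l"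
      using that by (intro add_pos_nonneg sum_nonneg) (auto simp: cond_A_def less_imp_le)
    then show ?thesis
      using assms(3) by (auto simp: cond_B_def)
  qed
  obtain v where v: "inj v" "independent (range v)"
    "\<And>i j. v i \<bullet> v j = orth_matrix l0 l $ i $ j" and C: "C = pos_hull (\<lambda>i. e i *\<^sub>R v i)"
    using assms(5) by (auto simp: orthocentric_cone_def)
  define E where "E = {x :: real ^ 'd. \<forall>i. e i * sgn (l i) * x $ i \<le> 0}"
  have e: "e i * e i = 1" "e i \<noteq> 0" for i
    using assms(4)[of i] by auto

  have span_C: "span C = span (range v)"
  proof (rule antisym)
    have "C \<subseteq> span (range v)"
      unfolding C pos_hull_def
      by (clarify, intro span_sum span_scale span_base rangeI)
    then show "span C \<subseteq> span (range v)"
      by (rule span_minimal) simp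
    \<comment> \<open>The generator \<open>e i *\<^sub>R v i\<close> lies in \<open>C\<close>, and
      scaling it by \<open>e i\<close> gives back \<open>v i\<close> because
      \<open>e i * e i = 1\<close>.\<close>
    have "v i \<in> span C" for i
    proof -
      have "(\<Sum>j\<in>UNIV. (if j = i then 1 else 0) *\<^sub>R (e j *\<^sub>R v j)) \<in> C"
        by (auto simp: C pos_hull_def)
      moreover have "(\<Sum>j\<in>UNIV. (if j = i then 1 else 0) *\<^sub>R (e j *\<^sub>R v j)) = e i *\<^sub>R v i"
        by (subst sum.remove[of _ i]) (auto intro!: sum.neutral)
      ultimately have "e i *\<^sub>R (e i *\<^sub>R v i) \<in> span C"
        by (metis span_base span_scale)
      then show ?thesis
        using e by simp
    qed
    then show "span (range v) \<subseteq> span C"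
      by (intro span_minimal) auto
  qed
  have "dim (span C) = CARD('d)"
    using v(1,2) by (simp add: span_C dim_eq_card_independent card_image)
  then obtain b :: "'d \<Rightarrow> real ^ 'n"
    where b: "\<And>i j. b i \<bullet> b j = (if i = j then 1 else 0)" "span (range b) = span C"
      and gauss: "std_gaussian_on (span C)
      = distr (density lborel (\<lambda>x :: real ^ 'd. exp (- (x \<bullet> x) / 2) / sqrt ((2 * pi) ^ CARD('d))))
          borel (\<lambda>x. \<Sum>i\<in>UNIV. x $ i *\<^sub>R b i)"
    using std_gaussian_on_subspace[of "span C"] by auto
  define U :: "real ^ 'd \<Rightarrow> real ^ 'n" where "U = (\<lambda>x. \<Sum>i\<in>UNIV. x $ i *\<^sub>R b i)"
  \<comment> \<open>Column \<open>j\<close> holds the coordinates of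
    \<open>- l j *\<^sub>R v j\<close> in the basis \<open>b\<close>, so \<open>U (M *v y)\<close>
    is the parametrisation of the span.\<close>
  define M :: "real ^ 'd ^ 'd" where "M = (\<chi> i j. - l j * (v j \<bullet> b i))"

  have v_expand: "v j = (\<Sum>i\<in>UNIV. (v j \<bullet> b i) *\<^sub>R b i)" for j
    using b(1) by (rule orthonormal_expansion) (simp add: b(2) span_C span_base)
  have U_M: "U (M *v y) = (\<Sum>j\<in>UNIV. (- y $ j * l j) *\<^sub>R v j)" for y
  proof -
    have "U (M *v y) = (\<Sum>i\<in>UNIV. \<Sum>j\<in>UNIV. (- y $ j * l j) *\<^sub>R ((v j \<bullet> b i) *\<^sub>R b i))"
      by (simp add: U_def M_def matrix_vector_mult_def scaleR_sum_left mult.commute mult.left_commute)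
    also have "\<dots> = (\<Sum>j\<in>UNIV. (- y $ j * l j) *\<^sub>R (\<Sum>i\<in>UNIV. (v j \<bullet> b i) *\<^sub>R b i))"
      unfolding scaleR_sum_right by (rule sum.swap)
    finally show ?thesis
      by (simp only: v_expand[symmetric])
  qed
  \<comment> \<open>Since \<open>b\<close> is orthonormal, this product is the Gram matrix of the
    vectors \<open>- l j *\<^sub>R v j\<close>; the minus signs cancel.\<close>
  have MtM: "transpose M ** M = (\<chi> i j. l i * l j * orth_matrix l0 l $ i $ j)"
  proof -
    have "(transpose M ** M) $ i $ k = l i * l k * (v i \<bullet> v k)" for i k
    proof -
      have "v i \<bullet> v k = (\<Sum>a\<in>UNIV. (v i \<bullet> b a) * (v k \<bullet> b a))"
        using arg_cong[OF v_expand[of i], of "\<lambda>x. x \<bullet> v k"]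
        by (simp add: inner_sum_left inner_commute[of "b _" "v k"])
      then show ?thesis
        by (simp add: M_def matrix_matrix_mult_def transpose_def sum_distrib_left mult_ac)
    qed
    then show ?thesis
      by (simp add: vec_eq_iff v(3))
  qed
  have inverse: "orth_matrix m l ** (transpose M ** M) = mat 1"
    unfolding MtM m_def using assms(1,2) nonzero by (rule orth_matrix_mult_inverse)
  \<comment> \<open>This one identity yields that \<open>M\<close> is invertible, that the
    covariance determinant is positive, and that \<open>\<bar>det M\<bar>\<close> is the ratio of
    the two normalising constants.\<close>
  have det: "det (orth_matrix m l) * (det M)\<^sup>2 = 1"
    using arg_cong[OF inverse, of det] by (simp add: det_mul det_transpose power2_eq_square)
  then have det_M: "det M \<noteq> 0"
    by auto
  then have det_pos: "0 < det (orth_matrix m l)"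
    using det zero_less_mult_pos2[of "det (orth_matrix m l)" "(det M)\<^sup>2"] by simp
  have sqrt_det: "\<bar>det M\<bar> = 1 / sqrt (det (orth_matrix m l))"
    using arg_cong[OF det, of sqrt] det_pos by (simp add: real_sqrt_mult eq_divide_eq mult.commute)
  have quadratic: "(M *v y) \<bullet> (M *v y) = y \<bullet> (matrix_inv (orth_matrix m l) *v y)" for y
    unfolding matrix_inv_eqI[OF inverse]
    by (simp add: matrix_vector_mul_assoc[symmetric] dot_lmul_matrix[symmetric] inner_commute)
  have U_M_in_C: "U (M *v y) \<in> C \<longleftrightarrow> y \<in> E" for y
  proof -
    \<comment> \<open>The left side is the coefficient of \<open>e i *\<^sub>R v i\<close> in
      \<open>U (M *v y)\<close>. Only the sign of \<open>l i\<close> affects whether it is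
      nonnegative.\<close>
    have sgn_iff: "0 \<le> - y $ i * l i * e i \<longleftrightarrow> e i * sgn (l i) * y $ i \<le> 0" for i
      using assms(2)[of i] assms(4)[of i]
      by (auto simp: sgn_if zero_le_mult_iff mult_le_0_iff)
    show ?thesis
    proof
      assume "U (M *v y) \<in> C"
      then obtain c where c: "\<And>i. 0 \<le> c i"
        and eq: "(\<Sum>j\<in>UNIV. (- y $ j * l j) *\<^sub>R v j) = (\<Sum>j\<in>UNIV. (c j * e j) *\<^sub>R v j)"
        by (auto simp: C pos_hull_def U_M)
      have "- y $ i * l i = c i * e i" for i
        using independent_sum_eqD[OF v(1,2) eq] .
      then have "- y $ i * l i * e i = c i" for i
        using e(1)[of i] by simp
      then show "y \<in> E"
        using c sgn_iff by (simp add: E_def)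
    next
      assume "y \<in> E"
      then have "0 \<le> - y $ i * l i * e i" for i
        using sgn_iff by (simp add: E_def)
      moreover have "U (M *v y) = (\<Sum>j\<in>UNIV. (- y $ j * l j * e j) *\<^sub>R (e j *\<^sub>R v j))"
        using e(1) by (simp add: U_M mult.assoc)
      ultimately show "U (M *v y) \<in> C"
        unfolding C pos_hull_def
        by (intro CollectI exI[of _ "\<lambda>j. - y $ j * l j * e j"] conjI allI)
    qed
  qed

  \<comment> \<open>The Gaussian measure of the cone\<close>
  have [measurable]: "C \<in> sets borel"
  proof -
    have "inj (\<lambda>x :: real ^ 'd. \<Sum>i\<in>UNIV. x $ i *\<^sub>R (e i *\<^sub>R v i))"
    proof (rule injI)
      fix x y :: "real ^ 'd"
      assume "(\<Sum>i\<in>UNIV. x $ i *\<^sub>R (e i *\<^sub>R v i)) = (\<Sum>i\<in>UNIV. y $ i *\<^sub>R (e i *\<^sub>R v i))"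
      then have eq: "(\<Sum>i\<in>UNIV. (x $ i * e i) *\<^sub>R v i) = (\<Sum>i\<in>UNIV. (y $ i * e i) *\<^sub>R v i)"
        by simp
      have "x $ i * e i = y $ i * e i" for i
        using independent_sum_eqD[OF v(1,2) eq] .
      then show "x = y"
        using e(2) by (simp add: vec_eq_iff)
    qed
    then show ?thesis
      unfolding C by (intro borel_closed closed_pos_hull)
  qed
  have [measurable]: "E \<in> sets borel"
    unfolding E_def
    by (intro borel_closed closed_Collect_all closed_Collect_le continuous_intros)
  have [measurable]: "U \<in> borel \<rightarrow>\<^sub>M borel"
    unfolding U_def by measurable
  let ?\<phi> = "\<lambda>x :: real ^ 'd. exp (- (x \<bullet> x) / 2) / sqrt ((2 * pi) ^ CARD('d))"
  let ?\<psi> = "\<lambda>x :: real ^ 'd. exp (- (x \<bullet> (matrix_inv (orth_matrix m l) *v x)) / 2)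
    / sqrt ((2 * pi) ^ CARD('d) * det (orth_matrix m l))"
  have U_C: "U -` C \<in> sets borel"
    using measurable_sets[of U borel borel C] by simp
  have "emeasure (std_gaussian_on (span C)) C = emeasure (density lborel ?\<phi>) (U -` C)"
    unfolding gauss U_def[symmetric] by (subst emeasure_distr) auto
  also have "\<dots> = (\<integral>\<^sup>+x. ennreal (?\<phi> x) * indicator (U -` C) x \<partial>lborel)"
    using U_C by (intro emeasure_density) simp_all
  \<comment> \<open>Substitution of \<open>M *v y\<close> for \<open>x\<close>; the Jacobian is then
    absorbed into the density \<open>?\<psi>\<close>.\<close>
  also have "\<dots> = \<bar>det M\<bar> * (\<integral>\<^sup>+y. ennreal (?\<phi> (M *v y)) * indicator (U -` C) (M *v y) \<partial>lborel)"
    using det_M U_C by (intro nn_integral_lborel_matrix) simp_all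
  also have "\<dots> = (\<integral>\<^sup>+y. ennreal \<bar>det M\<bar>
      * (ennreal (?\<phi> (M *v y)) * indicator (U -` C) (M *v y)) \<partial>lborel)"
    using U_C by (intro nn_integral_cmult[symmetric]) measurable
  also have "\<dots> = (\<integral>\<^sup>+y. ennreal (?\<psi> y) * indicator E y \<partial>lborel)"
  proof (rule nn_integral_cong)
    fix y
    have "\<bar>det M\<bar> * ?\<phi> (M *v y) = ?\<psi> y"
      unfolding sqrt_det quadratic by (simp add: real_sqrt_mult)
    then have "ennreal \<bar>det M\<bar> * ennreal (?\<phi> (M *v y)) = ennreal (?\<psi> y)"
      by (simp only: ennreal_mult'[symmetric] abs_ge_zero)
    moreover have "indicator (U -` C) (M *v y) = (indicator E y :: ennreal)"
      by (simp add: indicator_def U_M_in_C)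
    ultimately show "ennreal \<bar>det M\<bar> * (ennreal (?\<phi> (M *v y)) * indicator (U -` C) (M *v y))
        = ennreal (?\<psi> y) * indicator E y"
      by (simp only: mult.assoc[symmetric])
  qed
  also have "\<dots> = emeasure (centered_gaussian (orth_matrix m l)) E"
    unfolding centered_gaussian_def by (intro emeasure_density[symmetric]) simp_all
  finally show ?thesis
    by (simp add: solid_angle_def g_fun_def measure_def E_def m_def)
qed

end
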